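(* (Type soundness of the calculus $\mathcal{L}\text{-}\mathsf{Tr}$ defined in the context.) For all type environments $\Gamma$ (which play no role in what follows), all sets $V$ of meta-variables, all language definitions $\mathcal{L}$ and all expressions $e$: if the configuration $V;\mathcal{L};e$ is well-typed, i.e. $\vdash V;\mathcal{L};e$, then $V;\mathcal{L};e\longrightarrow^{*}V';\mathcal{L}';e'$ for some $V',\mathcal{L}',e'$ such that (i) $e'=\mathtt{skip}$, or (ii) $e'=\mathtt{error}$, or (iii) $V';\mathcal{L}';e'\longrightarrow V'';\mathcal{L}'';e''$ for some $V'',\mathcal{L}'',e''$. Here $\longrightarrow^{*}$ is the reflexive-transitive closure of $\longrightarrow$. The statement is made regardless of the choice of the predicate $\vdash\mathcal{L}$ on language definitions.
   Context: **Language definitions.** Fix pairwise disjoint sets CatName (elements $cname$), Meta-Var (elements $X,z$), OpName (elements $opname$), PredName (elements $predname$), and a meta-operation $\mathit{tick}$ giving a prime to a meta-variable ($X\mapsto X'$); there are always meta-variables outside any finite set and outside the range of $\mathit{tick}$. - Terms: $t ::= X\mid opname\ lt\mid (X)t\mid t[t/X]$ (the last two are syntax for unary binding and capture-avoiding substitution). - Formulae: $f ::= predname\ lt$. Rules: $r ::= \frac{lf}{f}$ (premises $lf$, conclusion $f$). - $lt,lf,R$ are lists (built with $\mathtt{nil},\mathtt{cons}$) of terms, formulae, rules. $[o_1,\dots,o_n]$ abbreviates a list. - A grammar $G$ is a finite set of productions $cname\ X::=lt$. A language definition is $\mathcal{L}=(G,R)$. $\mathit{vars}(\mathcal{L})$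 is the set of meta-variables of $\mathcal{L}$. - $\vdash\mathcal{L}$ is a notion of well-formedness of language definitions, chosen by the language designer (an arbitrary parameter). **Expressions.** $x,y$ range over a set Var containing $\mathit{self},\mathit{premises},\mathit{conclusion}$; $str$ ranges over strings. $e ::= x\mid cname\mid str\mid\hat t\mid\hat f\mid\hat r\mid\mathtt{nil}\mid\mathtt{cons}\ e\ e\mid\mathtt{head}\ e\mid\mathtt{tail}\ e\mid e\,@\,e\mid\mathtt{map}(e,e)\mid e(e)\mid\mathtt{mapKeys}\ e\mid\mathtt{just}\ e\mid\mathtt{nothing}\mid\mathtt{get}\ e\mid cname\ X::=e\mid cname\ X::=\ldots\,e\mid\mathtt{getRules}\mid\mathtt{setRules}\ e\mid e[p]{:}\,e\mid e(\mathtt{keep})[p]{:}\,e\mid\mathtt{uniquefy}(e,e,str)\Rightarrow(x,x){:}\,e\mid\mathtt{if}\ b\ \mathtt{then}\ e\ \mathtt{else}\ e\mid e\,;e\mid e\,;_{\mathsf r}e\mid\mathtt{skip}\mid\mathtt{newVar}\mid\mathtt{vars}(e)\mid e'\text{ (tick)}\mid\mathtt{fold}\ predname\ e\mid\mathtt{error}$ $b ::= e==e\mid\mathtt{isEmpty}\ e\mid e\ \mathtt{in}\ e\mid\mathtt{isNothing}\ e\mid b\ \mathtt{and}\ b\mid b\ \mathtt{or}\ b\mid\mathtt{not}\ b$ $\hat r ::= \frac{e}{e}$; $\ \hat f ::= predname\ e\mid x\ e$; $\ \hat t ::= X\mid opname\ e\mid x\ e\mid (X)e\mid e[e/X]$.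 Patterns: $p ::= x{:}T\mid predname\ p\mid opname\ p\mid x\ p\mid\mathtt{nil}\mid\mathtt{cons}\ p\ p$. Values: $v ::= t\mid f\mid r\mid cname\mid str\mid\mathtt{nil}\mid\mathtt{cons}\ v\ v\mid\mathtt{map}(v,v)\mid\mathtt{just}\ v\mid\mathtt{nothing}\mid\mathtt{skip}$. In the selectors $e_1[p]{:}e_2$ and $e_1(\mathtt{keep})[p]{:}e_2$ the variables of $p$ are bound in $e_2$; in $\mathtt{uniquefy}(e_1,e_2,str)\Rightarrow(x,y){:}e_3$, $x,y$ are bound in $e_3$. **Substitution.** $e[v/x]$ is standard capture-avoiding substitution, except that $\mathit{self},\mathit{premises},\mathit{conclusion}$ are not substituted in the contexts where they will be set at run time, namely the second argument of $;_{\mathsf r}$ and the body of a selector; e.g. $(e_1;_{\mathsf r}e_2)[v/\mathcal X]\equiv(e_1[v/\mathcal X]);_{\mathsf r}e_2$ for $\mathcal X\in\{\mathit{self},\mathit{premises},\mathit{conclusion}\}$. Sequences $\theta=[v_1/x_1,\dots,v_n/x_n]$ are applied left to right. For $r=\frac{v_1}{v_2}$ let $\theta_r=[r/\mathit{self},v_1/\mathit{premises},v_2/\mathit{conclusion}]$. **Pattern matching.** $\mathit{match}(v,p)$ is standard; it yields a substitution or fails: $x{:}T$ matches $v$ giving $[v/x]$; $predname\ p$ (resp. $opname\ p$) matches the same name applied to a list matched by $p$; $x\ p$ matches any name applied to a list matched by $p$, adding the association of $x$ with that name; $\mathtt{nil}$ matches $\mathtt{nil}$; $\mathtt{cons}\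 p_1\ p_2$ matches $\mathtt{cons}\ v_1\ v_2$ componentwise. **Evaluation contexts.** $E ::= \square\mid\mathtt{cons}\ E\ e\mid\mathtt{cons}\ v\ E\mid\mathtt{head}\ E\mid\mathtt{tail}\ E\mid E@e\mid v@E\mid\mathtt{map}(E,e)\mid\mathtt{map}(v,E)\mid E(e)\mid v(E)\mid\mathtt{mapKeys}\ E\mid\mathtt{just}\ E\mid\mathtt{get}\ E\mid cname\ X::=E\mid cname\ X::=\ldots E\mid\mathtt{setRules}\ E\mid E[p]{:}e\mid E(\mathtt{keep})[p]{:}e\mid\mathtt{uniquefy}(E,e,str)\Rightarrow(x,x){:}e\mid\mathtt{uniquefy}(v,E,str)\Rightarrow(x,x){:}e\mid\mathtt{fold}\ predname\ E\mid E;e\mid E;_{\mathsf r}e\mid\mathtt{vars}(E)\mid E'\mid\frac{e}{E}\mid\frac{E}{v}\mid predname\ E\mid opname\ E\mid(X)E\mid E[e/X]\mid v[E/X]$, and $\mathtt{if}\ B\ \mathtt{then}\ e\ \mathtt{else}\ e$ with $B ::= E==e\mid v==E\mid\mathtt{isEmpty}\ E\mid E\ \mathtt{in}\ e\mid v\ \mathtt{in}\ E\mid\mathtt{isNothing}\ E$. **Reduction of configurations** $V;\mathcal{L};e$ ($V$ is the set of meta-variables generated by $\mathtt{newVar}$): - if $V;\mathcal{L};e\to_@V';\mathcal{L}';e'$ and $\vdash\mathcal{L}'$ then $V;\mathcal{L};E[e]\longrightarrow V';\mathcal{L}';E[e']$; - if $V;\mathcal{L};e\to_@V';\mathcal{L}';e'$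 and not $\vdash\mathcal{L}'$ then $V;\mathcal{L};E[e]\longrightarrow V;\mathcal{L};\mathtt{error}$; - $V;\mathcal{L};E[\mathtt{error}]\longrightarrow V;\mathcal{L};\mathtt{error}$. **Atomic steps** $\to_@$, with $\mathcal{L}=(G,R)$; $V$ and $\mathcal{L}$ are unchanged unless displayed: - $cname\to_@v$ if $(cname\ X::=v)\in G$; $cname\to_@\mathtt{error}$ if there is no such production. - $\mathtt{getRules}\to_@R$; $V;(G,R);\mathtt{setRules}\ v\to_@V;(G,v);\mathtt{skip}$. - $V;(G,R);(cname\ X::=v)\to_@\emptyset;(G',R);\mathtt{skip}$, where $G'$ is $G$ with the production for $cname$ removed and $cname\ X::=v$ added. - $V;(G,R);(cname\ X::=\ldots v)\to_@\emptyset;(G,R);(cname\ X::=v'@v)$ if $(cname\ X::=v')\in G$; otherwise it steps to $\emptyset;(G,R);\mathtt{error}$. - $\mathtt{skip};e\to_@e$; $\ v\,;_{\mathsf r}e\to_@e\theta_v$ ($v$ a rule). - $\mathtt{nil}[p]{:}e\to_@\mathtt{nil}$. If $\mathit{match}(v_1,p)=\theta$: $(\mathtt{cons}\ v_1\ v_2)[p]{:}e\to_@\mathtt{cons}^*\,(e\theta\theta')\,(v_2[p]{:}e)$, where $\theta'=\theta_{v_1}$ if $v_1$ is a rule and $\theta'=[v_1/\mathit{self}]$ otherwise, and $\mathtt{cons}^*\,e_1\,e_2$ stands for $\mathtt{if}\ \mathtt{isNothing}\ e_1\ \mathtt{then}\ e_2\ \mathtt{else}\ \mathtt{cons}\ (\mathtt{get}\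 e_1)\ e_2$. If matching fails: $(\mathtt{cons}\ v_1\ v_2)[p]{:}e\to_@v_2[p]{:}e$. - Keep selector: the same three rules with $(\mathtt{keep})$, except that when matching fails $(\mathtt{cons}\ v_1\ v_2)(\mathtt{keep})[p]{:}e\to_@\mathtt{cons}\ v_1\ (v_2(\mathtt{keep})[p]{:}e)$. - $V;\mathcal{L};\mathtt{newVar}\to_@V\cup\{Y\};\mathcal{L};Y$ for a meta-variable $Y\notin V\cup\mathit{vars}(\mathcal{L})\cup\mathrm{range}(\mathit{tick})$. - $\mathtt{uniquefy}(lf,v_1,str)\Rightarrow(x,y){:}e\to_@e[lf'/x,v_2/y]$ if $U(lf,v_1,str,\mathtt{map}([],[]))=(lf',v_2)$, and $\to_@\mathtt{error}$ if this $U$ fails ($U$ is described below). - $\mathtt{fold}\ q\ \mathtt{nil}\to_@\mathtt{nil}$; $\mathtt{fold}\ q\ (\mathtt{cons}\ v\ \mathtt{nil})\to_@\mathtt{nil}$; $\mathtt{fold}\ q\ (\mathtt{cons}\ v_1(\mathtt{cons}\ v_2\ v_3))\to_@\mathtt{cons}\ (q\ [v_1,v_2])\ (\mathtt{fold}\ q\ (\mathtt{cons}\ v_2\ v_3))$, for $q$ a predicate name. - Tick: $(opname\ v)'\to_@opname\ (v')$; $(X)'\to_@\mathit{tick}(X)$ for a meta-variable $X$; $((z)t)'\to_@(z)(t')$; $(t_1[t_2/z])'\to_@(t_1')[t_2'/z]$; $(\mathtt{cons}\ v_1\ v_2)'\to_@\mathtt{cons}\ (v_1')\ (v_2')$; $\mathtt{nil}'\to_@\mathtt{nil}$.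 - $\mathtt{vars}$ traverses terms and lists of terms in the same way and returns the list of the meta-variables met. - Standard steps for lists, maps, options and conditionals: $\mathtt{head}$, $\mathtt{tail}$ of a cons give its components, and of $\mathtt{nil}$ give $\mathtt{error}$; $@$ is append; $\mathtt{map}(v_1,v_2)(k)$ gives the element of the list $v_2$ at the position of the key $k$ in the list $v_1$, or $\mathtt{error}$ if there is none; $\mathtt{mapKeys}\ \mathtt{map}(v_1,v_2)\to_@v_1$; $\mathtt{get}(\mathtt{just}\ v)\to_@v$ and $\mathtt{get}\ \mathtt{nothing}\to_@\mathtt{error}$; a conditional whose guard has value arguments steps to the branch selected by the truth value of the guard ($==$ equality, $\mathtt{isEmpty}$ being $\mathtt{nil}$, $\mathtt{in}$ list membership, $\mathtt{isNothing}$ being $\mathtt{nothing}$), and guards with $\mathtt{and}$, $\mathtt{or}$, $\mathtt{not}$ are reduced to nested conditionals as usual. **The meta-operation $U$.** $U(lf,m,s,\mu)$ takes a list of formulae $lf$, a map $m$ from operator/predicate names to lists of strings (one label per argument of the name), a string $s$, and a map $\mu$ in which the result map is accumulated. It either returns a pair $(lf',\mu')$, where $lf'$ is the modified list of formulae and $\mu'$ maps each replaced meta-variable to the list of new meta-variables that have replaced it, or it fails. It is a recursive traversal of lists of formulae, formulae, lists of terms and terms: when it meets a name that is a key of $m$, it pairs the arguments with the labels that $m$ gives for that name, failing if the two lists have different lengths; when an argument is in a position prescribed by $s$, its meta-variables are replaced by new (ticked) ones and the association is recorded. **Types.** $T ::= \mathtt{Language}\mid\mathtt{Rule}\mid\mathtt{Formula}\mid\mathtt{Term}\mid\mathtt{List}\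 T\mid\mathtt{Map}\ T\ T\mid\mathtt{Option}\ T\mid\mathtt{String}\mid\mathtt{OpName}\mid\mathtt{PredName}$. Environments $\Gamma ::= \emptyset\mid\Gamma,x{:}T$. $\Gamma_{\mathrm{rule}}$ is $\mathit{self}{:}\mathtt{Rule},\mathit{premises}{:}\mathtt{List\ Formula},\mathit{conclusion}{:}\mathtt{Formula}$. Pattern typing $\Gamma\vdash p:T\Rightarrow\Gamma'$ is standard ($\Gamma'$ collects the types of the pattern's variables): $(x{:}T):T\Rightarrow x{:}T$; if $p:\mathtt{List\ Term}\Rightarrow\Gamma'$ then $predname\ p:\mathtt{Formula}\Rightarrow\Gamma'$, $opname\ p:\mathtt{Term}\Rightarrow\Gamma'$, $x\ p:\mathtt{Term}\Rightarrow x{:}\mathtt{OpName},\Gamma'$ and $x\ p:\mathtt{Formula}\Rightarrow x{:}\mathtt{PredName},\Gamma'$; $\mathtt{nil}:\mathtt{List}\ T\Rightarrow\emptyset$; if $p_1:T\Rightarrow\Gamma_1$ and $p_2:\mathtt{List}\ T\Rightarrow\Gamma_2$ then $\mathtt{cons}\ p_1\ p_2:\mathtt{List}\ T\Rightarrow\Gamma_1,\Gamma_2$. Expression typing $\Gamma\vdash e:T$: - $\Gamma,x{:}T\vdash x:T$; $\Gamma\vdash str:\mathtt{String}$; $cname:\mathtt{List\ Term}$; $X:\mathtt{Term}$; $\mathtt{newVar}:\mathtt{Term}$; $\mathtt{skip}:\mathtt{Language}$; $\mathtt{getRules}:\mathtt{List\ Rule}$; $\mathtt{error}:T$ for every $T$.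 - If $\Gamma\vdash e:\mathtt{List\ Term}$ then $\Gamma\vdash opname\ e:\mathtt{Term}$; $\Gamma\vdash predname\ e:\mathtt{Formula}$; $\Gamma,x{:}\mathtt{OpName}\vdash x\ e:\mathtt{Term}$; $\Gamma,x{:}\mathtt{PredName}\vdash x\ e:\mathtt{Formula}$; $\Gamma\vdash\mathtt{fold}\ predname\ e:\mathtt{List\ Formula}$; $\Gamma\vdash(cname\ X::=e):\mathtt{Language}$; $\Gamma\vdash(cname\ X::=\ldots e):\mathtt{Language}$. - $(z)e:\mathtt{Term}$ if $e:\mathtt{Term}$; $e_1[e_2/z]:\mathtt{Term}$ if $e_1,e_2:\mathtt{Term}$; $\frac{e_1}{e_2}:\mathtt{Rule}$ if $e_1:\mathtt{List\ Formula}$ and $e_2:\mathtt{Formula}$. - $\mathtt{setRules}\ e:\mathtt{Language}$ if $e:\mathtt{List\ Rule}$; $e_1;e_2:\mathtt{Language}$ if $e_1,e_2:\mathtt{Language}$; $\Gamma\vdash e_1;_{\mathsf r}e_2:\mathtt{Rule}$ if $\Gamma\vdash e_1:\mathtt{Rule}$ and $\Gamma,\Gamma_{\mathrm{rule}}\vdash e_2:\mathtt{Rule}$. - $\Gamma\vdash e_1[p]{:}e_2:\mathtt{List}\ T'$ if $\Gamma\vdash e_1:\mathtt{List}\ T$, $\Gamma\vdash p:T\Rightarrow\Gamma'$ and $\Gamma,\Gamma',\Gamma''\vdash e_2:\mathtt{Option}\ T'$, where $\Gamma''=\Gamma_{\mathrm{rule}}$ if $T=\mathtt{Rule}$ and $\Gamma''=\mathit{self}{:}T$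 otherwise. The keep selector is typed analogously, with $T'=T$. - $\Gamma\vdash\mathtt{uniquefy}(e_1,e_2,str)\Rightarrow(x,y){:}e_3:T$ if $\Gamma\vdash e_1:\mathtt{List\ Formula}$, $\Gamma\vdash e_2:\mathtt{Map}\ T'\ (\mathtt{List\ String})$ with $T'=\mathtt{OpName}$ or $T'=\mathtt{PredName}$, and $\Gamma,x{:}\mathtt{List\ Formula},y{:}\mathtt{Map\ Term\ (List\ Term)}\vdash e_3:T$. - $\mathtt{vars}(e):\mathtt{List\ Term}$ and $e':T$ if $e:T$ with $T\in\{\mathtt{Term},\mathtt{List\ Term}\}$. - Standard rules for lists, maps, options and conditionals: $\mathtt{nil}:\mathtt{List}\ T$; $\mathtt{cons}\ e_1e_2:\mathtt{List}\ T$ if $e_1:T$, $e_2:\mathtt{List}\ T$; $\mathtt{head}\ e:T$ and $\mathtt{tail}\ e:\mathtt{List}\ T$ if $e:\mathtt{List}\ T$; $e_1@e_2:\mathtt{List}\ T$ if both have type $\mathtt{List}\ T$; $\mathtt{map}(e_1,e_2):\mathtt{Map}\ T_1T_2$ if $e_i:\mathtt{List}\ T_i$; $e_1(e_2):T_2$ if $e_1:\mathtt{Map}\ T_1T_2$, $e_2:T_1$; $\mathtt{mapKeys}\ e:\mathtt{List}\ T_1$ if $e:\mathtt{Map}\ T_1T_2$; $\mathtt{just}\ e:\mathtt{Option}\ T$ if $e:T$; $\mathtt{nothing}:\mathtt{Option}\ T$; $\mathtt{get}\ e:T$ if $e:\mathtt{Option}\ T$; $\mathtt{if}\ b\ \mathtt{then}\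 e_1\ \mathtt{else}\ e_2:T$ if $e_1,e_2:T$ and $b$ is well-typed (equal types around $==$, a list type for $\mathtt{isEmpty}$, $T_0$ and $\mathtt{List}\ T_0$ for $\mathtt{in}$, an option type for $\mathtt{isNothing}$, well-typed components for $\mathtt{and},\mathtt{or},\mathtt{not}$). **Configuration typing.** $\vdash V;\mathcal{L};e$ holds iff $V\cap\mathit{vars}(\mathcal{L})=\emptyset$, $\vdash\mathcal{L}$, and $\emptyset\vdash e:\mathtt{Language}$.
   Formalization: The set V of generated meta-variables is assumed finite; for V all meta-variables and an empty language, a well-typed program using newVar is stuck, so the claim for arbitrary sets V is false. *)

theory Defs
  imports Main "HOL-Library.FSet" "HOL-Library.Monad_Syntax"
begin

section \<open>Language definitions\<close>

text \<open>
  The pairwise disjoint name sets are type variables: \<open>'c\<close> for category names, \<open>'m\<close> for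
  meta-variables, \<open>'o\<close> for operator names, \<open>'p\<close> for predicate names.  Object-level binding is plain
  syntax, so terms are not identified up to alpha-equivalence.  The set functions \<open>mterm_mvars\<close>,
  \<open>mformula_mvars\<close> and \<open>mrule_mvars\<close> collect all occurrences of meta-variables, including those in
  binding position.
\<close>

datatype (mterm_mvars: 'm, 'o) mterm =
    MVar 'm
  | MOp 'o "('m, 'o) mterm list"
  | MBind 'm "('m, 'o) mterm"
  | MSub "('m, 'o) mterm" "('m, 'o) mterm" 'm  \<comment> \<open>\<open>MSub t u X\<close> is \<open>t[u/X]\<close>\<close>

datatype (mformula_mvars: 'm, 'o, 'p) mformula = MPred 'p "('m, 'o) mterm list"

datatype (mrule_mvars: 'm, 'o, 'p) mrule =
  MRule "('m, 'o, 'p) mformula list" "('m, 'o, 'p) mformula"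

type_synonym ('c, 'm, 'o) grammar = "('c \<times> 'm \<times> ('m, 'o) mterm list) fset"

type_synonym ('c, 'm, 'o, 'p) lang = "('c, 'm, 'o) grammar \<times> ('m, 'o, 'p) mrule list"

definition lang_mvars :: "('c, 'm, 'o, 'p) lang \<Rightarrow> 'm set" where
  "lang_mvars L =
     (\<Union>(c, X, ts) \<in> fset (fst L). insert X (\<Union>t \<in> set ts. mterm_mvars t)) \<union>
     (\<Union>r \<in> set (snd L). mrule_mvars r)"


section \<open>Types, patterns and expressions\<close>

datatype ty = TLanguage | TRule | TFormula | TTerm | TList ty | TMap ty ty | TOption ty
  | TString | TOpName | TPredName

datatype 'x var = Self | Premises | Conclusion | Var 'x

datatype ('o, 'p) name = OpN 'o | PredN 'p

datatype ('o, 'p, 'x) pat =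
    PVar "'x var" ty
  | PPred 'p "('o, 'p, 'x) pat"
  | POp 'o "('o, 'p, 'x) pat"
  | PVarApp "'x var" "('o, 'p, 'x) pat"
  | PNil
  | PCons "('o, 'p, 'x) pat" "('o, 'p, 'x) pat"

primrec pat_vars :: "('o, 'p, 'x) pat \<Rightarrow> 'x var set" where
  "pat_vars (PVar x T) = {x}"
| "pat_vars (PPred q p) = pat_vars p"
| "pat_vars (POp f p) = pat_vars p"
| "pat_vars (PVarApp x p) = insert x (pat_vars p)"
| "pat_vars PNil = {}"
| "pat_vars (PCons p1 p2) = pat_vars p1 \<union> pat_vars p2"

text \<open>Guards, over a type \<open>'e\<close> that is to be the type of expressions.\<close>

datatype 'e bexpr =
    BEq 'e 'e
  | BIsEmpty 'e
  | BIn 'e 'e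
  | BIsNothing 'e
  | BAnd "'e bexpr" "'e bexpr"
  | BOr "'e bexpr" "'e bexpr"
  | BNot "'e bexpr"

text \<open>
  \<open>EVarApp x e\<close> is the form \<open>x e\<close>, shared by term and formula expressions.  \<open>EName\<close> does not occur in
  source programs and has no typing rule: it is what the variable \<open>x\<close> of a pattern \<open>x p\<close> is replaced
  by when it occurs as an expression, for instance as a key of the map given to \<open>uniquefy\<close>.
  (The options of the datatype command only save processing time.)
\<close>

datatype (plugins only: size)
    (dead 'c, dead 'm, dead 'o, dead 'p, dead 'x) expr =
    EVar "'x var"
  | ECat 'c
  | EStr string
  | EMeta 'm
  | EOp 'o "('c, 'm, 'o, 'p, 'x) expr"
  | EBind 'm "('c, 'm, 'o, 'p, 'x) expr"
  | ETSub "('c, 'm, 'o, 'p, 'x) expr" "('c, 'm, 'o, 'p, 'x) expr" 'm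
      \<comment> \<open>\<open>ETSub e1 e2 X\<close> is \<open>e1[e2/X]\<close>\<close>
  | EPred 'p "('c, 'm, 'o, 'p, 'x) expr"
  | EVarApp "'x var" "('c, 'm, 'o, 'p, 'x) expr"
  | ERule "('c, 'm, 'o, 'p, 'x) expr" "('c, 'm, 'o, 'p, 'x) expr"
  | ENil
  | ECons "('c, 'm, 'o, 'p, 'x) expr" "('c, 'm, 'o, 'p, 'x) expr"
  | EHead "('c, 'm, 'o, 'p, 'x) expr"
  | ETail "('c, 'm, 'o, 'p, 'x) expr"
  | EAppend "('c, 'm, 'o, 'p, 'x) expr" "('c, 'm, 'o, 'p, 'x) expr"
  | EMap "('c, 'm, 'o, 'p, 'x) expr" "('c, 'm, 'o, 'p, 'x) expr"
  | ELookup "('c, 'm, 'o, 'p, 'x) expr" "('c, 'm, 'o, 'p, 'x) expr"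
      \<comment> \<open>\<open>ELookup e1 e2\<close> is \<open>e1(e2)\<close>\<close>
  | EMapKeys "('c, 'm, 'o, 'p, 'x) expr"
  | EJust "('c, 'm, 'o, 'p, 'x) expr"
  | ENothing
  | EGet "('c, 'm, 'o, 'p, 'x) expr"
  | EProd 'c 'm "('c, 'm, 'o, 'p, 'x) expr"
      \<comment> \<open>\<open>cname X ::= e\<close>\<close>
  | EProdExt 'c 'm "('c, 'm, 'o, 'p, 'x) expr"
      \<comment> \<open>\<open>cname X ::= ... e\<close>\<close>
  | EGetRules
  | ESetRules "('c, 'm, 'o, 'p, 'x) expr"
  | ESel "('c, 'm, 'o, 'p, 'x) expr" "('o, 'p, 'x) pat" "('c, 'm, 'o, 'p, 'x) expr"
  | EKeep "('c, 'm, 'o, 'p, 'x) expr" "('o, 'p, 'x) pat" "('c, 'm, 'o, 'p, 'x) expr"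
  | EUniquefy "('c, 'm, 'o, 'p, 'x) expr" "('c, 'm, 'o, 'p, 'x) expr" string
      "'x var" "'x var" "('c, 'm, 'o, 'p, 'x) expr"
  | EIf "('c, 'm, 'o, 'p, 'x) expr bexpr" "('c, 'm, 'o, 'p, 'x) expr" "('c, 'm, 'o, 'p, 'x) expr"
  | ESeq "('c, 'm, 'o, 'p, 'x) expr" "('c, 'm, 'o, 'p, 'x) expr"
  | ESeqR "('c, 'm, 'o, 'p, 'x) expr" "('c, 'm, 'o, 'p, 'x) expr"
      \<comment> \<open>the rule-level composition \<open>;\<^sub>r\<close>\<close>
  | ESkip
  | ENewVar
  | EVars "('c, 'm, 'o, 'p, 'x) expr"
  | ETick "('c, 'm, 'o, 'p, 'x) expr"
  | EFold 'p "('c, 'm, 'o, 'p, 'x) expr"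
  | EError
  | EName "('o, 'p) name"


section \<open>Values\<close>

definition e_list :: "('c, 'm, 'o, 'p, 'x) expr list \<Rightarrow> ('c, 'm, 'o, 'p, 'x) expr" where
  "e_list es = foldr ECons es ENil"

primrec e_term :: "('m, 'o) mterm \<Rightarrow> ('c, 'm, 'o, 'p, 'x) expr" where
  "e_term (MVar X) = EMeta X"
| "e_term (MOp f ts) = EOp f (e_list (map e_term ts))"
| "e_term (MBind z t) = EBind z (e_term t)"
| "e_term (MSub t u z) = ETSub (e_term t) (e_term u) z"

primrec e_formula :: "('m, 'o, 'p) mformula \<Rightarrow> ('c, 'm, 'o, 'p, 'x) expr" where
  "e_formula (MPred q ts) = EPred q (e_list (map e_term ts))"

primrec e_rule :: "('m, 'o, 'p) mrule \<Rightarrow> ('c, 'm, 'o, 'p, 'x) expr" where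
  "e_rule (MRule fs f) = ERule (e_list (map e_formula fs)) (e_formula f)"

inductive is_value :: "('c, 'm, 'o, 'p, 'x) expr \<Rightarrow> bool" where
  "is_value (e_term t)"
| "is_value (e_formula f)"
| "is_value (e_rule r)"
| "is_value (ECat c)"
| "is_value (EStr s)"
| "is_value (EName n)"
| "is_value ENil"
| "is_value v1 \<Longrightarrow> is_value v2 \<Longrightarrow> is_value (ECons v1 v2)"
| "is_value v1 \<Longrightarrow> is_value v2 \<Longrightarrow> is_value (EMap v1 v2)"
| "is_value v \<Longrightarrow> is_value (EJust v)"
| "is_value ENothing"
| "is_value ESkip"


section \<open>Substitution and pattern matching\<close>

text \<open>
  Only values and names are ever substituted.  These contain no expression variables, so no bound
  variable has to be renamed to avoid capture.  If \<open>x\<close> in \<open>x e\<close> is replaced by something that is not a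
  name (impossible for well-typed expressions), \<open>x\<close> is left in place.
\<close>

definition run_time_vars :: "'x var set" where
  "run_time_vars = {Self, Premises, Conclusion}"

primrec subst :: "'x var \<Rightarrow> ('c, 'm, 'o, 'p, 'x) expr \<Rightarrow> ('c, 'm, 'o, 'p, 'x) expr
    \<Rightarrow> ('c, 'm, 'o, 'p, 'x) expr" where
  "subst x v (EVar y) = (if y = x then v else EVar y)"
| "subst x v (ECat c) = ECat c"
| "subst x v (EStr s) = EStr s"
| "subst x v (EMeta X) = EMeta X"
| "subst x v (EOp f e) = EOp f (subst x v e)"
| "subst x v (EBind z e) = EBind z (subst x v e)"
| "subst x v (ETSub e1 e2 z) = ETSub (subst x v e1) (subst x v e2) z"
| "subst x v (EPred q e) = EPred q (subst x v e)"
| "subst x v (EVarApp y e) =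
     (if y = x
      then (case v of
              EName (OpN f) \<Rightarrow> EOp f (subst x v e)
            | EName (PredN q) \<Rightarrow> EPred q (subst x v e)
            | _ \<Rightarrow> EVarApp y (subst x v e))
      else EVarApp y (subst x v e))"
| "subst x v (ERule e1 e2) = ERule (subst x v e1) (subst x v e2)"
| "subst x v ENil = ENil"
| "subst x v (ECons e1 e2) = ECons (subst x v e1) (subst x v e2)"
| "subst x v (EHead e) = EHead (subst x v e)"
| "subst x v (ETail e) = ETail (subst x v e)"
| "subst x v (EAppend e1 e2) = EAppend (subst x v e1) (subst x v e2)"
| "subst x v (EMap e1 e2) = EMap (subst x v e1) (subst x v e2)"
| "subst x v (ELookup e1 e2) = ELookup (subst x v e1) (subst x v e2)"
| "subst x v (EMapKeys e) = EMapKeys (subst x v e)"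
| "subst x v (EJust e) = EJust (subst x v e)"
| "subst x v ENothing = ENothing"
| "subst x v (EGet e) = EGet (subst x v e)"
| "subst x v (EProd c X e) = EProd c X (subst x v e)"
| "subst x v (EProdExt c X e) = EProdExt c X (subst x v e)"
| "subst x v EGetRules = EGetRules"
| "subst x v (ESetRules e) = ESetRules (subst x v e)"
| "subst x v (ESel e1 p e2) =
     ESel (subst x v e1) p (if x \<in> pat_vars p \<union> run_time_vars then e2 else subst x v e2)"
| "subst x v (EKeep e1 p e2) =
     EKeep (subst x v e1) p (if x \<in> pat_vars p \<union> run_time_vars then e2 else subst x v e2)"
| "subst x v (EUniquefy e1 e2 s y z e3) =
     EUniquefy (subst x v e1) (subst x v e2) s y z (if x = y \<or> x = z then e3 else subst x v e3)"
| "subst x v (EIf b e1 e2) = EIf (map_bexpr (subst x v) b) (subst x v e1) (subst x v e2)"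
| "subst x v (ESeq e1 e2) = ESeq (subst x v e1) (subst x v e2)"
| "subst x v (ESeqR e1 e2) =
     ESeqR (subst x v e1) (if x \<in> run_time_vars then e2 else subst x v e2)"
| "subst x v ESkip = ESkip"
| "subst x v ENewVar = ENewVar"
| "subst x v (EVars e) = EVars (subst x v e)"
| "subst x v (ETick e) = ETick (subst x v e)"
| "subst x v (EFold q e) = EFold q (subst x v e)"
| "subst x v EError = EError"
| "subst x v (EName n) = EName n"

type_synonym ('c, 'm, 'o, 'p, 'x) substitution = "('x var \<times> ('c, 'm, 'o, 'p, 'x) expr) list"

definition substs :: "('c, 'm, 'o, 'p, 'x) substitution \<Rightarrow> ('c, 'm, 'o, 'p, 'x) expr
    \<Rightarrow> ('c, 'm, 'o, 'p, 'x) expr" where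
  "substs \<theta> e = fold (\<lambda>(x, v). subst x v) \<theta> e"

text \<open>
  The substitution performed when entering the body of a selector on the element \<open>v\<close>.  On a rule
  this is also the substitution performed by \<open>;\<^sub>r\<close>.
\<close>

definition self_subst :: "('c, 'm, 'o, 'p, 'x) expr \<Rightarrow> ('c, 'm, 'o, 'p, 'x) substitution" where
  "self_subst v = (case v of
       ERule v1 v2 \<Rightarrow> [(Self, v), (Premises, v1), (Conclusion, v2)]
     | _ \<Rightarrow> [(Self, v)])"

primrec pmatch :: "('c, 'm, 'o, 'p, 'x) expr \<Rightarrow> ('o, 'p, 'x) pat
    \<Rightarrow> ('c, 'm, 'o, 'p, 'x) substitution option" where
  "pmatch v (PVar x T) = Some [(x, v)]"
| "pmatch v (PPred q p) =
     (case v of EPred q' v' \<Rightarrow> (if q' = q then pmatch v' p else None) | _ \<Rightarrow> None)"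
| "pmatch v (POp f p) =
     (case v of EOp f' v' \<Rightarrow> (if f' = f then pmatch v' p else None) | _ \<Rightarrow> None)"
| "pmatch v (PVarApp x p) =
     (case v of
        EPred q v' \<Rightarrow> do { \<theta> \<leftarrow> pmatch v' p; Some ((x, EName (PredN q)) # \<theta>) }
      | EOp f v' \<Rightarrow> do { \<theta> \<leftarrow> pmatch v' p; Some ((x, EName (OpN f)) # \<theta>) }
      | _ \<Rightarrow> None)"
| "pmatch v PNil = (if v = ENil then Some [] else None)"
| "pmatch v (PCons p1 p2) =
     (case v of
        ECons v1 v2 \<Rightarrow> do { \<theta>1 \<leftarrow> pmatch v1 p1; \<theta>2 \<leftarrow> pmatch v2 p2; Some (\<theta>1 @ \<theta>2) }
      | _ \<Rightarrow> None)"


section \<open>The meta-operation behind uniquefy\<close>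

text \<open>
  Each replaced occurrence of \<open>X\<close> gets the first of \<open>X', X'', ...\<close> that is new: not in the set \<open>A\<close> of
  meta-variables of the original formulae and not already introduced, as recorded in \<open>\<mu>\<close>.
  (If \<open>tick\<close> has an orbit without new elements, which no genuine priming operation has, the result is
  an unspecified tick iterate of \<open>X\<close>.)
\<close>

type_synonym 'm renaming = "('m \<times> 'm list) list"

definition new_tick :: "('m \<Rightarrow> 'm) \<Rightarrow> 'm set \<Rightarrow> 'm renaming \<Rightarrow> 'm \<Rightarrow> 'm" where
  "new_tick tick A \<mu> X =
     (tick ^^ Suc (LEAST n. (tick ^^ Suc n) X \<notin> A \<union> (\<Union>(Z, Ys) \<in> set \<mu>. set Ys))) X"

fun record_new :: "'m \<Rightarrow> 'm \<Rightarrow> 'm renaming \<Rightarrow> 'm renaming" where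
  "record_new X Y [] = [(X, [Y])]"
| "record_new X Y ((Z, Ys) # \<mu>) =
     (if Z = X then (Z, Ys @ [Y]) # \<mu> else (Z, Ys) # record_new X Y \<mu>)"

text \<open>
  Replacement of all meta-variables of an argument; like the tick operation, it leaves meta-variables
  in binding position alone.
\<close>

fun rename_term :: "('m \<Rightarrow> 'm) \<Rightarrow> 'm set \<Rightarrow> ('m, 'o) mterm \<Rightarrow> 'm renaming
    \<Rightarrow> ('m, 'o) mterm \<times> 'm renaming"
  and rename_terms :: "('m \<Rightarrow> 'm) \<Rightarrow> 'm set \<Rightarrow> ('m, 'o) mterm list \<Rightarrow> 'm renaming
    \<Rightarrow> ('m, 'o) mterm list \<times> 'm renaming" where
  "rename_term tick A (MVar X) \<mu> =
     (let Y = new_tick tick A \<mu> X in (MVar Y, record_new X Y \<mu>))"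
| "rename_term tick A (MOp f ts) \<mu> =
     (let (ts', \<mu>') = rename_terms tick A ts \<mu> in (MOp f ts', \<mu>'))"
| "rename_term tick A (MBind z t) \<mu> =
     (let (t', \<mu>') = rename_term tick A t \<mu> in (MBind z t', \<mu>'))"
| "rename_term tick A (MSub t u z) \<mu> =
     (let (t', \<mu>1) = rename_term tick A t \<mu>; (u', \<mu>2) = rename_term tick A u \<mu>1
      in (MSub t' u' z, \<mu>2))"
| "rename_terms tick A [] \<mu> = ([], \<mu>)"
| "rename_terms tick A (t # ts) \<mu> =
     (let (t', \<mu>1) = rename_term tick A t \<mu>; (ts', \<mu>2) = rename_terms tick A ts \<mu>1
      in (t' # ts', \<mu>2))"

text \<open>
  The map from names to labels is given, as in \<open>map(v1, v2)\<close>, by a list of keys and a list of values.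
\<close>

type_synonym ('o, 'p) labelling = "('o, 'p) name list \<times> string list list"

text \<open>
  The labels of the \<open>k\<close> arguments of the name \<open>n\<close>: all \<open>None\<close> if \<open>n\<close> is not a key, and undefined if
  the number of labels for \<open>n\<close> is not \<open>k\<close>.
\<close>

definition arg_labels :: "('o, 'p) labelling \<Rightarrow> ('o, 'p) name \<Rightarrow> nat \<Rightarrow> string option list option" where
  "arg_labels m n k =
     (if n \<notin> set (fst m) then Some (replicate k None)
      else case map_of (zip (fst m) (snd m)) n of
        None \<Rightarrow> None
      | Some ls \<Rightarrow> if length ls = k then Some (map Some ls) else None)"

fun U_term :: "('m \<Rightarrow> 'm) \<Rightarrow> 'm set \<Rightarrow> ('o, 'p) labelling \<Rightarrow> string \<Rightarrow> ('m, 'o) mterm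
    \<Rightarrow> 'm renaming \<Rightarrow> (('m, 'o) mterm \<times> 'm renaming) option"
  and U_args :: "('m \<Rightarrow> 'm) \<Rightarrow> 'm set \<Rightarrow> ('o, 'p) labelling \<Rightarrow> string \<Rightarrow> ('m, 'o) mterm list
    \<Rightarrow> string option list \<Rightarrow> 'm renaming \<Rightarrow> (('m, 'o) mterm list \<times> 'm renaming) option" where
  "U_term tick A m s (MVar X) \<mu> = Some (MVar X, \<mu>)"
| "U_term tick A m s (MOp f ts) \<mu> =
     do { ls \<leftarrow> arg_labels m (OpN f) (length ts);
          (ts', \<mu>') \<leftarrow> U_args tick A m s ts ls \<mu>;
          Some (MOp f ts', \<mu>') }"
| "U_term tick A m s (MBind z t) \<mu> =
     do { (t', \<mu>') \<leftarrow> U_term tick A m s t \<mu>; Some (MBind z t', \<mu>') }"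
| "U_term tick A m s (MSub t u z) \<mu> =
     do { (t', \<mu>1) \<leftarrow> U_term tick A m s t \<mu>;
          (u', \<mu>2) \<leftarrow> U_term tick A m s u \<mu>1;
          Some (MSub t' u' z, \<mu>2) }"
| "U_args tick A m s [] ls \<mu> = Some ([], \<mu>)"
| "U_args tick A m s (t # ts) ls \<mu> =
     do { (t', \<mu>1) \<leftarrow>
            (if hd ls = Some s then Some (rename_term tick A t \<mu>) else U_term tick A m s t \<mu>);
          (ts', \<mu>2) \<leftarrow> U_args tick A m s ts (tl ls) \<mu>1;
          Some (t' # ts', \<mu>2) }"

primrec U_formula :: "('m \<Rightarrow> 'm) \<Rightarrow> 'm set \<Rightarrow> ('o, 'p) labelling \<Rightarrow> string \<Rightarrow> ('m, 'o, 'p) mformula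
    \<Rightarrow> 'm renaming \<Rightarrow> (('m, 'o, 'p) mformula \<times> 'm renaming) option" where
  "U_formula tick A m s (MPred q ts) \<mu> =
     do { ls \<leftarrow> arg_labels m (PredN q) (length ts);
          (ts', \<mu>') \<leftarrow> U_args tick A m s ts ls \<mu>;
          Some (MPred q ts', \<mu>') }"

fun U_formulas :: "('m \<Rightarrow> 'm) \<Rightarrow> 'm set \<Rightarrow> ('o, 'p) labelling \<Rightarrow> string \<Rightarrow> ('m, 'o, 'p) mformula list
    \<Rightarrow> 'm renaming \<Rightarrow> (('m, 'o, 'p) mformula list \<times> 'm renaming) option" where
  "U_formulas tick A m s [] \<mu> = Some ([], \<mu>)"
| "U_formulas tick A m s (f # fs) \<mu> =
     do { (f', \<mu>1) \<leftarrow> U_formula tick A m s f \<mu>;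
          (fs', \<mu>2) \<leftarrow> U_formulas tick A m s fs \<mu>1;
          Some (f' # fs', \<mu>2) }"

definition U :: "('m \<Rightarrow> 'm) \<Rightarrow> ('m, 'o, 'p) mformula list \<Rightarrow> ('o, 'p) labelling \<Rightarrow> string
    \<Rightarrow> 'm renaming \<Rightarrow> (('m, 'o, 'p) mformula list \<times> 'm renaming) option" where
  "U tick fs m s \<mu> = U_formulas tick (\<Union>f \<in> set fs. mformula_mvars f) m s fs \<mu>"

definition e_labelling :: "('o, 'p) labelling \<Rightarrow> ('c, 'm, 'o, 'p, 'x) expr" where
  "e_labelling m =
     EMap (e_list (map EName (fst m))) (e_list (map (\<lambda>ls. e_list (map EStr ls)) (snd m)))"

definition e_renaming :: "'m renaming \<Rightarrow> ('c, 'm, 'o, 'p, 'x) expr" where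
  "e_renaming \<mu> =
     EMap (e_list (map (\<lambda>(X, Ys). EMeta X) \<mu>)) (e_list (map (\<lambda>(X, Ys). e_list (map EMeta Ys)) \<mu>))"


section \<open>Reduction\<close>

inductive ectx :: "(('c, 'm, 'o, 'p, 'x) expr \<Rightarrow> ('c, 'm, 'o, 'p, 'x) expr) \<Rightarrow> bool"
  and bctx :: "(('c, 'm, 'o, 'p, 'x) expr \<Rightarrow> ('c, 'm, 'o, 'p, 'x) expr bexpr) \<Rightarrow> bool" where
  "ectx (\<lambda>h. h)"
| "ectx E \<Longrightarrow> ectx (\<lambda>h. ECons (E h) e)"
| "is_value v \<Longrightarrow> ectx E \<Longrightarrow> ectx (\<lambda>h. ECons v (E h))"
| "ectx E \<Longrightarrow> ectx (\<lambda>h. EHead (E h))"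
| "ectx E \<Longrightarrow> ectx (\<lambda>h. ETail (E h))"
| "ectx E \<Longrightarrow> ectx (\<lambda>h. EAppend (E h) e)"
| "is_value v \<Longrightarrow> ectx E \<Longrightarrow> ectx (\<lambda>h. EAppend v (E h))"
| "ectx E \<Longrightarrow> ectx (\<lambda>h. EMap (E h) e)"
| "is_value v \<Longrightarrow> ectx E \<Longrightarrow> ectx (\<lambda>h. EMap v (E h))"
| "ectx E \<Longrightarrow> ectx (\<lambda>h. ELookup (E h) e)"
| "is_value v \<Longrightarrow> ectx E \<Longrightarrow> ectx (\<lambda>h. ELookup v (E h))"
| "ectx E \<Longrightarrow> ectx (\<lambda>h. EMapKeys (E h))"
| "ectx E \<Longrightarrow> ectx (\<lambda>h. EJust (E h))"
| "ectx E \<Longrightarrow> ectx (\<lambda>h. EGet (E h))"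
| "ectx E \<Longrightarrow> ectx (\<lambda>h. EProd c X (E h))"
| "ectx E \<Longrightarrow> ectx (\<lambda>h. EProdExt c X (E h))"
| "ectx E \<Longrightarrow> ectx (\<lambda>h. ESetRules (E h))"
| "ectx E \<Longrightarrow> ectx (\<lambda>h. ESel (E h) p e)"
| "ectx E \<Longrightarrow> ectx (\<lambda>h. EKeep (E h) p e)"
| "ectx E \<Longrightarrow> ectx (\<lambda>h. EUniquefy (E h) e1 s x y e2)"
| "is_value v \<Longrightarrow> ectx E \<Longrightarrow> ectx (\<lambda>h. EUniquefy v (E h) s x y e)"
| "ectx E \<Longrightarrow> ectx (\<lambda>h. EFold q (E h))"
| "ectx E \<Longrightarrow> ectx (\<lambda>h. ESeq (E h) e)"
| "ectx E \<Longrightarrow> ectx (\<lambda>h. ESeqR (E h) e)"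
| "ectx E \<Longrightarrow> ectx (\<lambda>h. EVars (E h))"
| "ectx E \<Longrightarrow> ectx (\<lambda>h. ETick (E h))"
| "ectx E \<Longrightarrow> ectx (\<lambda>h. ERule e (E h))"
| "is_value v \<Longrightarrow> ectx E \<Longrightarrow> ectx (\<lambda>h. ERule (E h) v)"
| "ectx E \<Longrightarrow> ectx (\<lambda>h. EPred q (E h))"
| "ectx E \<Longrightarrow> ectx (\<lambda>h. EOp f (E h))"
| "ectx E \<Longrightarrow> ectx (\<lambda>h. EBind z (E h))"
| "ectx E \<Longrightarrow> ectx (\<lambda>h. ETSub (E h) e z)"
| "is_value v \<Longrightarrow> ectx E \<Longrightarrow> ectx (\<lambda>h. ETSub v (E h) z)"
| "bctx B \<Longrightarrow> ectx (\<lambda>h. EIf (B h) e1 e2)"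
| "ectx E \<Longrightarrow> bctx (\<lambda>h. BEq (E h) e)"
| "is_value v \<Longrightarrow> ectx E \<Longrightarrow> bctx (\<lambda>h. BEq v (E h))"
| "ectx E \<Longrightarrow> bctx (\<lambda>h. BIsEmpty (E h))"
| "ectx E \<Longrightarrow> bctx (\<lambda>h. BIn (E h) e)"
| "is_value v \<Longrightarrow> ectx E \<Longrightarrow> bctx (\<lambda>h. BIn v (E h))"
| "ectx E \<Longrightarrow> bctx (\<lambda>h. BIsNothing (E h))"

fun list_mem :: "('c, 'm, 'o, 'p, 'x) expr \<Rightarrow> ('c, 'm, 'o, 'p, 'x) expr \<Rightarrow> bool" where
  "list_mem v (ECons v1 v2) = (v = v1 \<or> list_mem v v2)"
| "list_mem v _ = False"

abbreviation e_cons_opt :: "('c, 'm, 'o, 'p, 'x) expr \<Rightarrow> ('c, 'm, 'o, 'p, 'x) expr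
    \<Rightarrow> ('c, 'm, 'o, 'p, 'x) expr" where
  "e_cons_opt e1 e2 \<equiv> EIf (BIsNothing e1) e2 (ECons (EGet e1) e2)"

text \<open>The atomic steps that neither inspect nor change the language and the set \<open>V\<close>.\<close>

inductive pure_step :: "('m \<Rightarrow> 'm) \<Rightarrow> ('c, 'm, 'o, 'p, 'x) expr \<Rightarrow> ('c, 'm, 'o, 'p, 'x) expr \<Rightarrow> bool"
  for tick :: "'m \<Rightarrow> 'm" where
  "pure_step tick (ESeq ESkip e) e"
| "pure_step tick (ESeqR (e_rule r) e) (substs (self_subst (e_rule r)) e)"

| "pure_step tick (ESel ENil p e) ENil"
| "is_value v1 \<Longrightarrow> is_value v2 \<Longrightarrow> pmatch v1 p = Some \<theta> \<Longrightarrow>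
     pure_step tick (ESel (ECons v1 v2) p e)
       (e_cons_opt (substs (self_subst v1) (substs \<theta> e)) (ESel v2 p e))"
| "is_value v1 \<Longrightarrow> is_value v2 \<Longrightarrow> pmatch v1 p = None \<Longrightarrow>
     pure_step tick (ESel (ECons v1 v2) p e) (ESel v2 p e)"
| "pure_step tick (EKeep ENil p e) ENil"
| "is_value v1 \<Longrightarrow> is_value v2 \<Longrightarrow> pmatch v1 p = Some \<theta> \<Longrightarrow>
     pure_step tick (EKeep (ECons v1 v2) p e)
       (e_cons_opt (substs (self_subst v1) (substs \<theta> e)) (EKeep v2 p e))"
| "is_value v1 \<Longrightarrow> is_value v2 \<Longrightarrow> pmatch v1 p = None \<Longrightarrow>
     pure_step tick (EKeep (ECons v1 v2) p e) (ECons v1 (EKeep v2 p e))"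

| "U tick fs m s [] = Some (fs', \<mu>) \<Longrightarrow>
     pure_step tick (EUniquefy (e_list (map e_formula fs)) (e_labelling m) s x y e)
       (substs [(x, e_list (map e_formula fs')), (y, e_renaming \<mu>)] e)"
| "U tick fs m s [] = None \<Longrightarrow>
     pure_step tick (EUniquefy (e_list (map e_formula fs)) (e_labelling m) s x y e) EError"

| "pure_step tick (EFold q ENil) ENil"
| "is_value v \<Longrightarrow> pure_step tick (EFold q (ECons v ENil)) ENil"
| "is_value v1 \<Longrightarrow> is_value v2 \<Longrightarrow> is_value v3 \<Longrightarrow>
     pure_step tick (EFold q (ECons v1 (ECons v2 v3)))
       (ECons (EPred q (e_list [v1, v2])) (EFold q (ECons v2 v3)))"

| "is_value v \<Longrightarrow> pure_step tick (ETick (EOp f v)) (EOp f (ETick v))"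
| "pure_step tick (ETick (EMeta X)) (EMeta (tick X))"
| "pure_step tick (ETick (EBind z (e_term t))) (EBind z (ETick (e_term t)))"
| "pure_step tick (ETick (ETSub (e_term t) (e_term u) z))
     (ETSub (ETick (e_term t)) (ETick (e_term u)) z)"
| "is_value v1 \<Longrightarrow> is_value v2 \<Longrightarrow>
     pure_step tick (ETick (ECons v1 v2)) (ECons (ETick v1) (ETick v2))"
| "pure_step tick (ETick ENil) ENil"

| "is_value v \<Longrightarrow> pure_step tick (EVars (EOp f v)) (EVars v)"
| "pure_step tick (EVars (EMeta X)) (ECons (EMeta X) ENil)"
| "pure_step tick (EVars (EBind z (e_term t))) (EVars (e_term t))"
| "pure_step tick (EVars (ETSub (e_term t) (e_term u) z))
     (EAppend (EVars (e_term t)) (EVars (e_term u)))"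
| "is_value v1 \<Longrightarrow> is_value v2 \<Longrightarrow>
     pure_step tick (EVars (ECons v1 v2)) (EAppend (EVars v1) (EVars v2))"
| "pure_step tick (EVars ENil) ENil"

| "is_value v1 \<Longrightarrow> is_value v2 \<Longrightarrow> pure_step tick (EHead (ECons v1 v2)) v1"
| "pure_step tick (EHead ENil) EError"
| "is_value v1 \<Longrightarrow> is_value v2 \<Longrightarrow> pure_step tick (ETail (ECons v1 v2)) v2"
| "pure_step tick (ETail ENil) EError"
| "is_value v \<Longrightarrow> pure_step tick (EAppend ENil v) v"
| "is_value v1 \<Longrightarrow> is_value v2 \<Longrightarrow> is_value v \<Longrightarrow>
     pure_step tick (EAppend (ECons v1 v2) v) (ECons v1 (EAppend v2 v))"
| "\<forall>v \<in> set ks. is_value v \<Longrightarrow> \<forall>v \<in> set vs. is_value v \<Longrightarrow> is_value k \<Longrightarrow>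
     map_of (zip ks vs) k = Some v \<Longrightarrow>
     pure_step tick (ELookup (EMap (e_list ks) (e_list vs)) k) v"
| "\<forall>v \<in> set ks. is_value v \<Longrightarrow> \<forall>v \<in> set vs. is_value v \<Longrightarrow> is_value k \<Longrightarrow>
     map_of (zip ks vs) k = None \<Longrightarrow>
     pure_step tick (ELookup (EMap (e_list ks) (e_list vs)) k) EError"
| "is_value v1 \<Longrightarrow> is_value v2 \<Longrightarrow> pure_step tick (EMapKeys (EMap v1 v2)) v1"
| "is_value v \<Longrightarrow> pure_step tick (EGet (EJust v)) v"
| "pure_step tick (EGet ENothing) EError"

| "is_value v1 \<Longrightarrow> is_value v2 \<Longrightarrow>
     pure_step tick (EIf (BEq v1 v2) e1 e2) (if v1 = v2 then e1 else e2)"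
| "is_value v \<Longrightarrow> pure_step tick (EIf (BIsEmpty v) e1 e2) (if v = ENil then e1 else e2)"
| "is_value v1 \<Longrightarrow> is_value v2 \<Longrightarrow>
     pure_step tick (EIf (BIn v1 v2) e1 e2) (if list_mem v1 v2 then e1 else e2)"
| "is_value v \<Longrightarrow> pure_step tick (EIf (BIsNothing v) e1 e2) (if v = ENothing then e1 else e2)"
| "pure_step tick (EIf (BAnd b1 b2) e1 e2) (EIf b1 (EIf b2 e1 e2) e2)"
| "pure_step tick (EIf (BOr b1 b2) e1 e2) (EIf b1 e1 (EIf b2 e1 e2))"
| "pure_step tick (EIf (BNot b) e1 e2) (EIf b e2 e1)"

type_synonym ('c, 'm, 'o, 'p, 'x) config =
  "'m set \<times> ('c, 'm, 'o, 'p) lang \<times> ('c, 'm, 'o, 'p, 'x) expr"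

inductive atomic_step :: "('m \<Rightarrow> 'm) \<Rightarrow> ('c, 'm, 'o, 'p, 'x) config
    \<Rightarrow> ('c, 'm, 'o, 'p, 'x) config \<Rightarrow> bool"
  for tick :: "'m \<Rightarrow> 'm" where
  "pure_step tick e e' \<Longrightarrow> atomic_step tick (V, L, e) (V, L, e')"
| "(c, X, ts) |\<in>| G \<Longrightarrow>
     atomic_step tick (V, (G, R), ECat c) (V, (G, R), e_list (map e_term ts))"
| "\<forall>X ts. (c, X, ts) |\<notin>| G \<Longrightarrow> atomic_step tick (V, (G, R), ECat c) (V, (G, R), EError)"
| "atomic_step tick (V, (G, R), EGetRules) (V, (G, R), e_list (map e_rule R))"
| "atomic_step tick (V, (G, R), ESetRules (e_list (map e_rule R'))) (V, (G, R'), ESkip)"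
| "atomic_step tick (V, (G, R), EProd c X (e_list (map e_term ts)))
     ({}, (finsert (c, X, ts) (ffilter (\<lambda>(c', _, _). c' \<noteq> c) G), R), ESkip)"
| "is_value v \<Longrightarrow> (c, X, ts) |\<in>| G \<Longrightarrow>
     atomic_step tick (V, (G, R), EProdExt c X v)
       ({}, (G, R), EProd c X (EAppend (e_list (map e_term ts)) v))"
| "is_value v \<Longrightarrow> \<forall>ts. (c, X, ts) |\<notin>| G \<Longrightarrow>
     atomic_step tick (V, (G, R), EProdExt c X v) ({}, (G, R), EError)"
| "Y \<notin> V \<union> lang_mvars L \<union> range tick \<Longrightarrow>
     atomic_step tick (V, L, ENewVar) (V \<union> {Y}, L, EMeta Y)"

text \<open>The predicate \<open>lang_ok\<close> is the designer's notion of well-formed language definition.\<close>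

inductive step :: "('m \<Rightarrow> 'm) \<Rightarrow> (('c, 'm, 'o, 'p) lang \<Rightarrow> bool) \<Rightarrow> ('c, 'm, 'o, 'p, 'x) config
    \<Rightarrow> ('c, 'm, 'o, 'p, 'x) config \<Rightarrow> bool"
  for tick :: "'m \<Rightarrow> 'm" and lang_ok :: "('c, 'm, 'o, 'p) lang \<Rightarrow> bool" where
  "atomic_step tick (V, L, e) (V', L', e') \<Longrightarrow> ectx E \<Longrightarrow> lang_ok L' \<Longrightarrow>
     step tick lang_ok (V, L, E e) (V', L', E e')"
| "atomic_step tick (V, L, e) (V', L', e') \<Longrightarrow> ectx E \<Longrightarrow> \<not> lang_ok L' \<Longrightarrow>
     step tick lang_ok (V, L, E e) (V, L, EError)"
| "ectx E \<Longrightarrow> step tick lang_ok (V, L, E EError) (V, L, EError)"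


section \<open>Typing\<close>

text \<open>Later declarations override earlier ones, both in \<open>\<Gamma>(x \<mapsto> T)\<close> and in \<open>\<Gamma> ++ \<Gamma>'\<close>.\<close>

type_synonym 'x env = "'x var \<rightharpoonup> ty"

definition env_rule :: "'x env" where
  "env_rule = [Self \<mapsto> TRule, Premises \<mapsto> TList TFormula, Conclusion \<mapsto> TFormula]"

definition env_self :: "ty \<Rightarrow> 'x env" where
  "env_self T = (if T = TRule then env_rule else [Self \<mapsto> T])"

inductive pat_typing :: "'x env \<Rightarrow> ('o, 'p, 'x) pat \<Rightarrow> ty \<Rightarrow> 'x env \<Rightarrow> bool"
  for \<Gamma> :: "'x env" where
  "pat_typing \<Gamma> (PVar x T) T [x \<mapsto> T]"
| "pat_typing \<Gamma> p (TList TTerm) \<Gamma>' \<Longrightarrow> pat_typing \<Gamma> (PPred q p) TFormula \<Gamma>'"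
| "pat_typing \<Gamma> p (TList TTerm) \<Gamma>' \<Longrightarrow> pat_typing \<Gamma> (POp f p) TTerm \<Gamma>'"
| "pat_typing \<Gamma> p (TList TTerm) \<Gamma>' \<Longrightarrow>
     pat_typing \<Gamma> (PVarApp x p) TTerm ([x \<mapsto> TOpName] ++ \<Gamma>')"
| "pat_typing \<Gamma> p (TList TTerm) \<Gamma>' \<Longrightarrow>
     pat_typing \<Gamma> (PVarApp x p) TFormula ([x \<mapsto> TPredName] ++ \<Gamma>')"
| "pat_typing \<Gamma> PNil (TList T) Map.empty"
| "pat_typing \<Gamma> p1 T \<Gamma>1 \<Longrightarrow> pat_typing \<Gamma> p2 (TList T) \<Gamma>2 \<Longrightarrow>
     pat_typing \<Gamma> (PCons p1 p2) (TList T) (\<Gamma>1 ++ \<Gamma>2)"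

inductive typing :: "'x env \<Rightarrow> ('c, 'm, 'o, 'p, 'x) expr \<Rightarrow> ty \<Rightarrow> bool"
  and typing_b :: "'x env \<Rightarrow> ('c, 'm, 'o, 'p, 'x) expr bexpr \<Rightarrow> bool" where
  "\<Gamma> x = Some T \<Longrightarrow> typing \<Gamma> (EVar x) T"
| "typing \<Gamma> (EStr s) TString"
| "typing \<Gamma> (ECat c) (TList TTerm)"
| "typing \<Gamma> (EMeta X) TTerm"
| "typing \<Gamma> ENewVar TTerm"
| "typing \<Gamma> ESkip TLanguage"
| "typing \<Gamma> EGetRules (TList TRule)"
| "typing \<Gamma> EError T"

| "typing \<Gamma> e (TList TTerm) \<Longrightarrow> typing \<Gamma> (EOp f e) TTerm"
| "typing \<Gamma> e (TList TTerm) \<Longrightarrow> typing \<Gamma> (EPred q e) TFormula"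
| "\<Gamma> x = Some TOpName \<Longrightarrow> typing \<Gamma> e (TList TTerm) \<Longrightarrow> typing \<Gamma> (EVarApp x e) TTerm"
| "\<Gamma> x = Some TPredName \<Longrightarrow> typing \<Gamma> e (TList TTerm) \<Longrightarrow> typing \<Gamma> (EVarApp x e) TFormula"
| "typing \<Gamma> e (TList TTerm) \<Longrightarrow> typing \<Gamma> (EFold q e) (TList TFormula)"
| "typing \<Gamma> e (TList TTerm) \<Longrightarrow> typing \<Gamma> (EProd c X e) TLanguage"
| "typing \<Gamma> e (TList TTerm) \<Longrightarrow> typing \<Gamma> (EProdExt c X e) TLanguage"

| "typing \<Gamma> e TTerm \<Longrightarrow> typing \<Gamma> (EBind z e) TTerm"
| "typing \<Gamma> e1 TTerm \<Longrightarrow> typing \<Gamma> e2 TTerm \<Longrightarrow> typing \<Gamma> (ETSub e1 e2 z) TTerm"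
| "typing \<Gamma> e1 (TList TFormula) \<Longrightarrow> typing \<Gamma> e2 TFormula \<Longrightarrow> typing \<Gamma> (ERule e1 e2) TRule"

| "typing \<Gamma> e (TList TRule) \<Longrightarrow> typing \<Gamma> (ESetRules e) TLanguage"
| "typing \<Gamma> e1 TLanguage \<Longrightarrow> typing \<Gamma> e2 TLanguage \<Longrightarrow> typing \<Gamma> (ESeq e1 e2) TLanguage"
| "typing \<Gamma> e1 TRule \<Longrightarrow> typing (\<Gamma> ++ env_rule) e2 TRule \<Longrightarrow> typing \<Gamma> (ESeqR e1 e2) TRule"

| "typing \<Gamma> e1 (TList T) \<Longrightarrow> pat_typing \<Gamma> p T \<Gamma>' \<Longrightarrow>
     typing (\<Gamma> ++ \<Gamma>' ++ env_self T) e2 (TOption T') \<Longrightarrow> typing \<Gamma> (ESel e1 p e2) (TList T')"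
| "typing \<Gamma> e1 (TList T) \<Longrightarrow> pat_typing \<Gamma> p T \<Gamma>' \<Longrightarrow>
     typing (\<Gamma> ++ \<Gamma>' ++ env_self T) e2 (TOption T) \<Longrightarrow> typing \<Gamma> (EKeep e1 p e2) (TList T)"

| "typing \<Gamma> e1 (TList TFormula) \<Longrightarrow> typing \<Gamma> e2 (TMap T' (TList TString)) \<Longrightarrow>
     T' = TOpName \<or> T' = TPredName \<Longrightarrow>
     typing (\<Gamma>(x \<mapsto> TList TFormula, y \<mapsto> TMap TTerm (TList TTerm))) e3 T \<Longrightarrow>
     typing \<Gamma> (EUniquefy e1 e2 s x y e3) T"

| "typing \<Gamma> e T \<Longrightarrow> T = TTerm \<or> T = TList TTerm \<Longrightarrow> typing \<Gamma> (EVars e) (TList TTerm)"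
| "typing \<Gamma> e T \<Longrightarrow> T = TTerm \<or> T = TList TTerm \<Longrightarrow> typing \<Gamma> (ETick e) T"

| "typing \<Gamma> ENil (TList T)"
| "typing \<Gamma> e1 T \<Longrightarrow> typing \<Gamma> e2 (TList T) \<Longrightarrow> typing \<Gamma> (ECons e1 e2) (TList T)"
| "typing \<Gamma> e (TList T) \<Longrightarrow> typing \<Gamma> (EHead e) T"
| "typing \<Gamma> e (TList T) \<Longrightarrow> typing \<Gamma> (ETail e) (TList T)"
| "typing \<Gamma> e1 (TList T) \<Longrightarrow> typing \<Gamma> e2 (TList T) \<Longrightarrow> typing \<Gamma> (EAppend e1 e2) (TList T)"
| "typing \<Gamma> e1 (TList T1) \<Longrightarrow> typing \<Gamma> e2 (TList T2) \<Longrightarrow> typing \<Gamma> (EMap e1 e2) (TMap T1 T2)"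
| "typing \<Gamma> e1 (TMap T1 T2) \<Longrightarrow> typing \<Gamma> e2 T1 \<Longrightarrow> typing \<Gamma> (ELookup e1 e2) T2"
| "typing \<Gamma> e (TMap T1 T2) \<Longrightarrow> typing \<Gamma> (EMapKeys e) (TList T1)"
| "typing \<Gamma> e T \<Longrightarrow> typing \<Gamma> (EJust e) (TOption T)"
| "typing \<Gamma> ENothing (TOption T)"
| "typing \<Gamma> e (TOption T) \<Longrightarrow> typing \<Gamma> (EGet e) T"
| "typing_b \<Gamma> b \<Longrightarrow> typing \<Gamma> e1 T \<Longrightarrow> typing \<Gamma> e2 T \<Longrightarrow> typing \<Gamma> (EIf b e1 e2) T"

| "typing \<Gamma> e1 T \<Longrightarrow> typing \<Gamma> e2 T \<Longrightarrow> typing_b \<Gamma> (BEq e1 e2)"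
| "typing \<Gamma> e (TList T) \<Longrightarrow> typing_b \<Gamma> (BIsEmpty e)"
| "typing \<Gamma> e1 T \<Longrightarrow> typing \<Gamma> e2 (TList T) \<Longrightarrow> typing_b \<Gamma> (BIn e1 e2)"
| "typing \<Gamma> e (TOption T) \<Longrightarrow> typing_b \<Gamma> (BIsNothing e)"
| "typing_b \<Gamma> b1 \<Longrightarrow> typing_b \<Gamma> b2 \<Longrightarrow> typing_b \<Gamma> (BAnd b1 b2)"
| "typing_b \<Gamma> b1 \<Longrightarrow> typing_b \<Gamma> b2 \<Longrightarrow> typing_b \<Gamma> (BOr b1 b2)"
| "typing_b \<Gamma> b \<Longrightarrow> typing_b \<Gamma> (BNot b)"

definition config_typing :: "(('c, 'm, 'o, 'p) lang \<Rightarrow> bool) \<Rightarrow> 'm set \<Rightarrow> ('c, 'm, 'o, 'p) lang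
    \<Rightarrow> ('c, 'm, 'o, 'p, 'x) expr \<Rightarrow> bool" where
  "config_typing lang_ok V L e \<longleftrightarrow>
     V \<inter> lang_mvars L = {} \<and> lang_ok L \<and> typing Map.empty e TLanguage"

end

theory Submission
  imports Defs
begin

text \<open>
  Zero reduction steps suffice, so the theorem amounts to progress: a closed well-typed expression
  either is a canonical value of its type or decomposes into an evaluation context around \<open>error\<close> or
  around an atomic redex.  Such a redex always makes the configuration step, since a result that is
  not well-formed leads to \<open>error\<close>.
\<close>

section \<open>Canonical values\<close>

text \<open>
  A category name is both a value and a redex, so \<open>is_value\<close> is too liberal for canonical forms:
  \<open>canon\<close> contains no category names.  No source expression denotes an operator or predicate name,
  whence the two empty sets.
\<close>

primrec canon :: "ty \<Rightarrow> ('c, 'm, 'o, 'p, 'x) expr set" where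
  "canon TLanguage = {ESkip}"
| "canon TRule = range e_rule"
| "canon TFormula = range e_formula"
| "canon TTerm = range e_term"
| "canon (TList T) = e_list ` lists (canon T)"
| "canon (TMap T1 T2) =
     (\<lambda>(ks, vs). EMap (e_list ks) (e_list vs)) ` (lists (canon T1) \<times> lists (canon T2))"
| "canon (TOption T) = insert ENothing (EJust ` canon T)"
| "canon TString = range EStr"
| "canon TOpName = {}"
| "canon TPredName = {}"

lemma e_list_simps [simp]:
  "e_list [] = ENil"
  "e_list (e # es) = ECons e (e_list es)"
  by (simp_all add: e_list_def)

lemma ENil_in_canon: "ENil \<in> canon (TList T)"
  by (auto intro: image_eqI[of _ _ "[]"])

lemma ECons_in_canon:
  assumes "v1 \<in> canon T" and "v2 \<in> canon (TList T)"
  shows "ECons v1 v2 \<in> canon (TList T)"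
proof -
  obtain vs where "v2 = e_list vs" "vs \<in> lists (canon T)"
    using assms(2) by auto
  then have "ECons v1 v2 = e_list (v1 # vs)" "v1 # vs \<in> lists (canon T)"
    using assms(1) by auto
  then show ?thesis by (simp only: canon.simps) blast
qed

lemma canon_list_cases:
  assumes "v \<in> canon (TList T)"
  obtains "v = ENil"
  | v1 v2 where "v = ECons v1 v2" "v1 \<in> canon T" "v2 \<in> canon (TList T)"
proof -
  obtain vs where vs: "v = e_list vs" "vs \<in> lists (canon T)"
    using assms by auto
  show thesis
  proof (cases vs)
    case Nil
    then show thesis using vs that(1) by simp
  next
    case (Cons a as)
    then show thesis using vs that(2)[of a "e_list as"] by auto
  qed
qed

text \<open>A list of encodings is the encoding of one object-level list. The rules for
  \<open>ESetRules\<close>, \<open>EProd\<close> and \<open>EUniquefy\<close> are stated for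
  arguments of that form.\<close>

lemma canon_list_image:
  "canon (TList TTerm) = range (\<lambda>ts. e_list (map e_term ts))"
  "canon (TList TFormula) = range (\<lambda>fs. e_list (map e_formula fs))"
  "canon (TList TRule) = range (\<lambda>rs. e_list (map e_rule rs))"
  "canon (TList TString) = range (\<lambda>ss. e_list (map EStr ss))"
  by (simp_all add: lists_image image_image)

lemma is_value_e_list: "\<forall>v \<in> set vs. is_value v \<Longrightarrow> is_value (e_list vs)"
  by (induction vs) (auto intro: is_value.intros)

text \<open>Supplies the side condition that contexts and many atomic steps impose.\<close>

lemma canon_is_value: "v \<in> canon T \<Longrightarrow> is_value v"
proof (induction T arbitrary: v)
  case (TList T)
  then show ?case by (auto intro!: is_value_e_list)
next
  case (TMap T1 T2)
  then show ?case by (auto intro!: is_value.intros(9) is_value_e_list)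
qed (auto intro: is_value.intros)

text \<open>The tick and vars rules at an operator ask for a value as argument list.\<close>

lemma is_value_term_list: "is_value (e_list (map e_term ts))"
  by (auto intro!: is_value_e_list is_value.intros)

section \<open>Decomposition into a context and a redex\<close>

text \<open>The predicate \<open>lang_ok\<close> is absent: it only decides which of two rules of
  \<open>step\<close> applies to the redex.\<close>

definition active :: "('m \<Rightarrow> 'm) \<Rightarrow> 'm set \<Rightarrow> ('c, 'm, 'o, 'p) lang
    \<Rightarrow> ('c, 'm, 'o, 'p, 'x) expr \<Rightarrow> bool" where
  "active tick V L e \<longleftrightarrow>
     (\<exists>E h. ectx E \<and> e = E h \<and> (h = EError \<or> (\<exists>c. atomic_step tick (V, L, h) c)))"

lemma active_error: "active tick V L EError"
  unfolding active_def using ectx_bctx.intros(1) by fastforce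

lemma active_atomic: "atomic_step tick (V, L, e) c \<Longrightarrow> active tick V L e"
  unfolding active_def using ectx_bctx.intros(1) by fastforce

lemma active_pure: "pure_step tick e e' \<Longrightarrow> active tick V L e"
  by (rule active_atomic, rule atomic_step.intros(1))

text \<open>The same redex serves, inside the composed context
  \<open>\<lambda>h. F (E h)\<close>.\<close>

lemma active_frame:
  assumes "active tick V L e" and "\<And>E. ectx E \<Longrightarrow> ectx (\<lambda>h. F (E h))"
  shows "active tick V L (F e)"
  using assms unfolding active_def by metis

lemma active_step:
  assumes "active tick V L e"
  shows "\<exists>V' L' e'. step tick lang_ok (V, L, e) (V', L', e')"
proof -
  obtain E h where E: "ectx E" "e = E h" and h: "h = EError \<or> (\<exists>c. atomic_step tick (V, L, h) c)"
    using assms unfolding active_def by blast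
  show ?thesis
  proof (cases "h = EError")
    case True
    then show ?thesis using E step.intros(3) by blast
  next
    case False
    then obtain V' L' h' where "atomic_step tick (V, L, h) (V', L', h')"
      using h by (metis prod.exhaust)
    then show ?thesis
      using E step.intros(1)[of tick V L h V' L' h' E lang_ok]
        step.intros(2)[of tick V L h V' L' h' E lang_ok] by blast
  qed
qed

text \<open>One frame per production of the evaluation contexts. Guard frames are contexts only
  inside \<open>EIf\<close>, hence the whole conditional. In \<open>ERule\<close> the conclusion is
  evaluated before the premises.\<close>

lemma active_frames:
  fixes e :: "('c, 'm, 'o, 'p, 'x) expr"
  assumes "active tick V L e"
  shows "active tick V L (ECons e e')"
    and "is_value v \<Longrightarrow> active tick V L (ECons v e)"
    and "active tick V L (EHead e)"
    and "active tick V L (ETail e)"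
    and "active tick V L (EAppend e e')"
    and "is_value v \<Longrightarrow> active tick V L (EAppend v e)"
    and "active tick V L (EMap e e')"
    and "is_value v \<Longrightarrow> active tick V L (EMap v e)"
    and "active tick V L (ELookup e e')"
    and "is_value v \<Longrightarrow> active tick V L (ELookup v e)"
    and "active tick V L (EMapKeys e)"
    and "active tick V L (EJust e)"
    and "active tick V L (EGet e)"
    and "active tick V L (EProd c X e)"
    and "active tick V L (EProdExt c X e)"
    and "active tick V L (ESetRules e)"
    and "active tick V L (ESel e p e')"
    and "active tick V L (EKeep e p e')"
    and "active tick V L (EUniquefy e e' s x y e'')"
    and "is_value v \<Longrightarrow> active tick V L (EUniquefy v e s x y e')"
    and "active tick V L (EFold q e)"
    and "active tick V L (ESeq e e')"
    and "active tick V L (ESeqR e e')"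
    and "active tick V L (EVars e)"
    and "active tick V L (ETick e)"
    and "active tick V L (ERule e' e)"
    and "is_value v \<Longrightarrow> active tick V L (ERule e v)"
    and "active tick V L (EPred q e)"
    and "active tick V L (EOp f e)"
    and "active tick V L (EBind z e)"
    and "active tick V L (ETSub e e' z)"
    and "is_value v \<Longrightarrow> active tick V L (ETSub v e z)"
    and "active tick V L (EIf (BEq e e') e1 e2)"
    and "is_value v \<Longrightarrow> active tick V L (EIf (BEq v e) e1 e2)"
    and "active tick V L (EIf (BIsEmpty e) e1 e2)"
    and "active tick V L (EIf (BIn e e') e1 e2)"
    and "is_value v \<Longrightarrow> active tick V L (EIf (BIn v e) e1 e2)"
    and "active tick V L (EIf (BIsNothing e) e1 e2)"
  by (rule active_frame[OF assms], (rule ectx_bctx.intros; assumption?)+)+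

section \<open>Progress\<close>

lemma finite_mterm_mvars: "finite (mterm_mvars t)"
  by (induction t) auto

text \<open>A grammar is a finite set and the rules form a list, so finiteness reduces to that of
  single terms.\<close>

lemma finite_lang_mvars: "finite (lang_mvars L)"
proof -
  have f: "finite (mformula_mvars f)" for f :: "('m, 'o, 'p) mformula"
    by (cases f) (auto simp: finite_mterm_mvars)
  have "finite (mrule_mvars r)" for r :: "('m, 'o, 'p) mrule"
    by (cases r) (auto simp: f)
  then show ?thesis
    unfolding lang_mvars_def by (auto simp: finite_mterm_mvars)
qed

section \<open>Operations whose arguments are canonical values are redexes\<close>

lemma active_ETick:
  assumes "v \<in> canon T" and "T = TTerm \<or> T = TList TTerm"
  shows "active tick V L (ETick v)"
  using assms(2)
proof
  assume "T = TTerm"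
  then obtain t where "v = e_term t" using assms(1) by auto
  then show ?thesis
    by (cases t) (auto intro: active_pure pure_step.intros is_value_term_list)
next
  assume "T = TList TTerm"
  then have "v \<in> canon (TList TTerm)" using assms(1) by simp
  then show ?thesis
    by (cases rule: canon_list_cases) (blast intro: active_pure pure_step.intros canon_is_value)+
qed

lemma active_EVars:
  assumes "v \<in> canon T" and "T = TTerm \<or> T = TList TTerm"
  shows "active tick V L (EVars v)"
  using assms(2)
proof
  assume "T = TTerm"
  then obtain t where "v = e_term t" using assms(1) by auto
  then show ?thesis
    by (cases t) (auto intro: active_pure pure_step.intros is_value_term_list)
next
  assume "T = TList TTerm"
  then have "v \<in> canon (TList TTerm)" using assms(1) by simp
  then show ?thesis
    by (cases rule: canon_list_cases) (blast intro: active_pure pure_step.intros canon_is_value)+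
qed

lemma active_ESel:
  assumes "v \<in> canon (TList T)"
  shows "active tick V L (ESel v p e)"
  using assms
proof (cases rule: canon_list_cases)
  case 1
  then show ?thesis by (auto intro: active_pure pure_step.intros)
next
  case (2 v1 v2)
  then show ?thesis
    by (cases "pmatch v1 p") (blast intro: active_pure pure_step.intros canon_is_value)+
qed

lemma active_EKeep:
  assumes "v \<in> canon (TList T)"
  shows "active tick V L (EKeep v p e)"
  using assms
proof (cases rule: canon_list_cases)
  case 1
  then show ?thesis by (auto intro: active_pure pure_step.intros)
next
  case (2 v1 v2)
  then show ?thesis
    by (cases "pmatch v1 p") (blast intro: active_pure pure_step.intros canon_is_value)+
qed

lemma active_EFold:
  assumes "v \<in> canon (TList T)"
  shows "active tick V L (EFold q v)"
  using assms
proof (cases rule: canon_list_cases)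
  case 1
  then show ?thesis by (auto intro: active_pure pure_step.intros)
next
  case (2 v1 v2)
  \<comment> \<open>The fold rules distinguish empty, singleton and longer lists, so the tail is
    split as well.\<close>
  from 2(3) show ?thesis
    using 2(1,2)
    by (cases rule: canon_list_cases) (blast intro: active_pure pure_step.intros canon_is_value)+
qed

text \<open>The key and value lists of a canonical map may differ in length. Then \<open>zip\<close>
  truncates, and a key left without a value leads to \<open>EError\<close>.\<close>

lemma active_ELookup:
  assumes "v \<in> canon (TMap T1 T2)" and "k \<in> canon T1"
  shows "active tick V L (ELookup v k)"
proof -
  obtain ks vs where v: "v = EMap (e_list ks) (e_list vs)"
    and "ks \<in> lists (canon T1)" "vs \<in> lists (canon T2)"
    using assms(1) by auto
  then have "\<forall>w \<in> set ks. is_value w" "\<forall>w \<in> set vs. is_value w"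
    by (auto intro: canon_is_value)
  then show ?thesis
    unfolding v using canon_is_value[OF assms(2)]
    by (cases "map_of (zip ks vs) k") (blast intro: active_pure pure_step.intros)+
qed

lemma active_EMapKeys:
  assumes "v \<in> canon (TMap T1 T2)"
  shows "active tick V L (EMapKeys v)"
  using assms by (force intro: active_pure pure_step.intros is_value_e_list canon_is_value)

text \<open>The keys of a closed map from names are an empty list, so the labelling is trivial.\<close>

lemma active_EUniquefy:
  assumes "v1 \<in> canon (TList TFormula)" and "v2 \<in> canon (TMap T (TList TString))"
    and "T = TOpName \<or> T = TPredName"
  shows "active tick V L (EUniquefy v1 v2 s x y e)"
proof -
  obtain fs where v1: "v1 = e_list (map e_formula fs)"
    using assms(1) unfolding canon_list_image by auto
  obtain ks vs where v2: "v2 = EMap (e_list ks) (e_list vs)"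
    and "ks \<in> lists (canon T)" and vs: "vs \<in> lists (canon (TList TString))"
    using assms(2) unfolding canon.simps(6) by (elim imageE SigmaE) simp
  \<comment> \<open>\<open>canon T\<close> is empty for both name types, so nothing can head the
    list.\<close>
  then have "ks = []" using assms(3) by (cases ks) auto
  \<comment> \<open>The value list may be nonempty although there are no keys; \<open>sss\<close>
    holds its labels.\<close>
  with v2 vs obtain sss where "v2 = EMap ENil (e_list (map (\<lambda>ss. e_list (map EStr ss)) sss))"
    unfolding canon_list_image lists_image by auto
  then have "v2 = e_labelling ([], sss)"
    by (simp add: e_labelling_def)
  then show ?thesis
    unfolding v1
    by (cases "U tick fs ([], sss) s []") (auto intro!: active_pure intro: pure_step.intros)
qed

lemma active_lang:
  "active tick V L (ECat c)"
  "active tick V L EGetRules"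
  "v \<in> canon (TList TRule) \<Longrightarrow> active tick V L (ESetRules v)"
  "v \<in> canon (TList TTerm) \<Longrightarrow> active tick V L (EProd c X v)"
  "v \<in> canon (TList TTerm) \<Longrightarrow> active tick V L (EProdExt c X v)"
proof -
  obtain G R where L: "L = (G, R)" by fastforce
  show "active tick V L (ECat c)"
    unfolding L by (cases "\<exists>X ts. (c, X, ts) |\<in>| G") (blast intro: active_atomic atomic_step.intros)+
  show "active tick V L EGetRules"
    unfolding L by (blast intro: active_atomic atomic_step.intros)
  show "active tick V L (ESetRules v)" if "v \<in> canon (TList TRule)"
    using that unfolding L canon_list_image by (blast intro: active_atomic atomic_step.intros)
  show "active tick V L (EProd c X v)" if "v \<in> canon (TList TTerm)"
    using that unfolding L canon_list_image by (blast intro: active_atomic atomic_step.intros)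
  show "active tick V L (EProdExt c X v)" if "v \<in> canon (TList TTerm)"
    using canon_is_value[OF that] unfolding L
    \<comment> \<open>The split keeps \<open>X\<close> fixed: the extension looks for a production
      with this very meta-variable, whereas \<open>ECat\<close> accepts any.\<close>
    by (cases "\<exists>ts. (c, X, ts) |\<in>| G") (blast intro: active_atomic atomic_step.intros)+
qed

text \<open>These are the cases of progress where an expression with finished parts is itself
  finished.\<close>

lemma canon_intros:
  "e \<in> canon (TList TTerm) \<Longrightarrow> EOp f e \<in> canon TTerm"
  "e \<in> canon (TList TTerm) \<Longrightarrow> EPred q e \<in> canon TFormula"
  "EMeta X \<in> canon TTerm"
  "e \<in> canon TTerm \<Longrightarrow> EBind z e \<in> canon TTerm"
  "e1 \<in> canon TTerm \<Longrightarrow> e2 \<in> canon TTerm \<Longrightarrow> ETSub e1 e2 z \<in> canon TTerm"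
  "e1 \<in> canon (TList TFormula) \<Longrightarrow> e2 \<in> canon TFormula \<Longrightarrow> ERule e1 e2 \<in> canon TRule"
  "EStr s \<in> canon TString"
  "ESkip \<in> canon TLanguage"
  "ENil \<in> canon (TList T)"
  "v1 \<in> canon T \<Longrightarrow> v2 \<in> canon (TList T) \<Longrightarrow> ECons v1 v2 \<in> canon (TList T)"
  "v1 \<in> canon (TList T1) \<Longrightarrow> v2 \<in> canon (TList T2) \<Longrightarrow> EMap v1 v2 \<in> canon (TMap T1 T2)"
  "v \<in> canon T \<Longrightarrow> EJust v \<in> canon (TOption T)"
  "ENothing \<in> canon (TOption T)"
proof -
  show "EOp f e \<in> canon TTerm" if "e \<in> canon (TList TTerm)"
    \<comment> \<open>The preimage is built with the object-level constructor that
      \<open>EOp\<close> encodes; likewise below.\<close>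
    using that unfolding canon_list_image by (auto intro: range_eqI[of _ _ "MOp f _"])
  show "EPred q e \<in> canon TFormula" if "e \<in> canon (TList TTerm)"
    using that unfolding canon_list_image by (auto intro: range_eqI[of _ _ "MPred q _"])
  show "EMeta X \<in> canon TTerm"
    by (auto intro: range_eqI[of _ _ "MVar X"])
  show "EBind z e \<in> canon TTerm" if "e \<in> canon TTerm"
    using that by (auto intro: range_eqI[of _ _ "MBind z _"])
  show "ETSub e1 e2 z \<in> canon TTerm" if "e1 \<in> canon TTerm" "e2 \<in> canon TTerm"
    using that by (auto intro: range_eqI[of _ _ "MSub _ _ z"])
  show "ERule e1 e2 \<in> canon TRule" if "e1 \<in> canon (TList TFormula)" "e2 \<in> canon TFormula"
    using that unfolding canon_list_image by (auto intro: range_eqI[of _ _ "MRule _ _"])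
  show "ECons v1 v2 \<in> canon (TList T)" if "v1 \<in> canon T" "v2 \<in> canon (TList T)"
    using that by (rule ECons_in_canon)
qed (use ENil_in_canon in auto)

lemma active_redexes:
  "v \<in> canon (TList T) \<Longrightarrow> active tick V L (EHead v)"
  "v \<in> canon (TList T) \<Longrightarrow> active tick V L (ETail v)"
  "v \<in> canon (TList T) \<Longrightarrow> w \<in> canon (TList T) \<Longrightarrow> active tick V L (EAppend v w)"
  "u \<in> canon (TOption T) \<Longrightarrow> active tick V L (EGet u)"
  "l \<in> canon TLanguage \<Longrightarrow> active tick V L (ESeq l e)"
  "r \<in> canon TRule \<Longrightarrow> active tick V L (ESeqR r e)"
proof -
  show "active tick V L (EHead v)" "active tick V L (ETail v)" if "v \<in> canon (TList T)"
    using that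
    by (cases rule: canon_list_cases; blast intro: active_pure pure_step.intros canon_is_value)+
  show "active tick V L (EAppend v w)" if "v \<in> canon (TList T)" "w \<in> canon (TList T)"
    using that
    by (cases rule: canon_list_cases) (blast intro: active_pure pure_step.intros canon_is_value)+
qed (auto intro: active_pure pure_step.intros canon_is_value)

text \<open>The four basic guards are decided on arbitrary values. The Boolean connectives unfold at
  once into nested conditionals, whatever their components.\<close>

lemma active_guards:
  "is_value v \<Longrightarrow> is_value w \<Longrightarrow> active tick V L (EIf (BEq v w) e1 e2)"
  "is_value v \<Longrightarrow> active tick V L (EIf (BIsEmpty v) e1 e2)"
  "is_value v \<Longrightarrow> is_value w \<Longrightarrow> active tick V L (EIf (BIn v w) e1 e2)"
  "is_value v \<Longrightarrow> active tick V L (EIf (BIsNothing v) e1 e2)"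
  "active tick V L (EIf (BAnd b1 b2) e1 e2)"
  "active tick V L (EIf (BOr b1 b2) e1 e2)"
  "active tick V L (EIf (BNot b1) e1 e2)"
  by (blast intro: active_pure pure_step.intros)+

text \<open>Apart from \<open>range tick\<close>, only a finite set has to be avoided, so the
  assumption on \<open>tick\<close> supplies \<open>Y\<close>.\<close>

lemma active_ENewVar:
  assumes "\<forall>F. finite F \<longrightarrow> (\<exists>Y. Y \<notin> F \<and> Y \<notin> range tick)" and "finite V"
  shows "active tick V L ENewVar"
proof -
  obtain Y where "Y \<notin> V \<union> lang_mvars L" "Y \<notin> range tick"
    using assms finite_lang_mvars[of L] by (meson finite_UnI)
  then show ?thesis
    by (intro active_atomic[OF atomic_step.intros(9)]) auto
qed

text \<open>Simultaneous induction on typing. The equation for \<open>\<Gamma>\<close> excludes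
  expression variables; bodies of binders have larger environments, but contexts never enter them. A
  guard progresses only within a conditional, so its branches \<open>e1\<close> and
  \<open>e2\<close> are generalised.\<close>

lemma progress:
  fixes e :: "('c, 'm, 'o, 'p, 'x) expr"
  assumes tick: "\<forall>F. finite F \<longrightarrow> (\<exists>Y. Y \<notin> F \<and> Y \<notin> range tick)" and fin: "finite V"
  shows "typing \<Gamma> e T \<Longrightarrow> \<Gamma> = Map.empty \<Longrightarrow> e \<in> canon T \<or> active tick V L e"
    and "typing_b \<Gamma> b \<Longrightarrow> \<Gamma> = Map.empty \<Longrightarrow> active tick V L (EIf b e1 e2)"
  \<comment> \<open>Canonical sets must stay folded to match the lemmas above.\<close>
  supply canon.simps [simp del]
  by (induction \<Gamma> e T and \<Gamma> b arbitrary: and e1 e2 rule: typing_typing_b.inducts)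
    (blast intro: canon_intros canon_is_value active_frames active_redexes active_guards active_lang
       active_error active_ENewVar[OF assms] active_ETick active_EVars active_ESel active_EKeep
       active_EFold active_ELookup active_EMapKeys active_EUniquefy | simp)+

theorem theorem1:
  fixes tick :: "'m \<Rightarrow> 'm"
    and lang_ok :: "('c, 'm, 'o, 'p) lang \<Rightarrow> bool"
    and V :: "'m set"
    and L :: "('c, 'm, 'o, 'p) lang"
    and e :: "('c, 'm, 'o, 'p, 'x) expr"
  assumes tick: "\<forall>F. finite F \<longrightarrow> (\<exists>Y. Y \<notin> F \<and> Y \<notin> range tick)"
    and fin: "finite V"
    and typed: "config_typing lang_ok V L e"
  shows "\<forall>\<Gamma> :: 'x env. \<exists>V' L' e'.
     (step tick lang_ok)\<^sup>*\<^sup>* (V, L, e) (V', L', e') \<and>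
     (e' = ESkip \<or> e' = EError \<or> (\<exists>V'' L'' e''. step tick lang_ok (V', L', e') (V'', L'', e'')))"
proof -
  have "typing Map.empty e TLanguage"
    using typed by (simp add: config_typing_def)
  from progress(1)[OF tick fin this refl]
  \<comment> \<open>\<open>canon TLanguage\<close> is \<open>{ESkip}\<close>. The expression
    \<open>EError\<close> falls under \<open>active\<close>: in the empty context it steps to
    itself.\<close>
  have "e = ESkip \<or> active tick V L e" by simp
  then have "e = ESkip \<or> (\<exists>V'' L'' e''. step tick lang_ok (V, L, e) (V'', L'', e''))"
    using active_step by blast
  then show ?thesis by blast
qed

end
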